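(* Let $\Phi=\{\varphi_i\}_{i=1}^M$ be a finite family of vectors in a vector space and let $k\ge 1$ be an integer. Then the following are equivalent. (i) The family $\Phi$ can be partitioned into sets $\{A_i\}_{i=1}^k$ such that $A_i$ is linearly independent for all $i=1,2,\ldots,k$. (ii) For every subset $J\subseteq\Phi$, $|J|/\dim\operatorname{span}(J)\le k$.
   Context: $\Phi=\{\varphi_i\}_{i=1}^M$ is a finite indexed family (repetitions allowed); subsets, cardinalities and partitions of $\Phi$ are understood in terms of the index set $\{1,\dots,M\}$, so a subfamily with a repeated vector is linearly dependent. The sets $A_i$ of the partition are allowed to be empty. The inequality $|J|/\dim\operatorname{span}(J)\le k$ is understood as $|J|\le k\,\dim\operatorname{span}(J)$ (which settles its meaning when $\dim\operatorname{span}(J)=0$). *)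

theory Defs
  imports Complex_Main "HOL-Library.Disjoint_Sets"
begin

text \<open>
  Linear independence of the subfamily of \<open>\<phi>\<close> with index set \<open>I\<close>. The library's
  notion is about sets of vectors; injectivity makes a family with a repeated vector
  dependent. The coefficient form is \<open>independent_family_iff\<close> below.
\<close>

definition (in module) independent_family :: "('i \<Rightarrow> 'b) \<Rightarrow> 'i set \<Rightarrow> bool"
  where "independent_family \<phi> I \<longleftrightarrow> inj_on \<phi> I \<and> independent (\<phi> ` I)"

lemma (in vector_space) independent_family_iff:
  assumes "finite I"
  shows "independent_family \<phi> I \<longleftrightarrow>
    (\<forall>c. (\<Sum>i\<in>I. c i *s \<phi> i) = 0 \<longrightarrow> (\<forall>i\<in>I. c i = 0))"
proof
  assume ind: "independent_family \<phi> I"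
  show "\<forall>c. (\<Sum>i\<in>I. c i *s \<phi> i) = 0 \<longrightarrow> (\<forall>i\<in>I. c i = 0)"
  proof (intro allI impI ballI)
    fix c i assume c: "(\<Sum>i\<in>I. c i *s \<phi> i) = 0" and i: "i \<in> I"
    have inj: "inj_on \<phi> I" and lin: "independent (\<phi> ` I)"
      using ind by (auto simp: independent_family_def)
    let ?u = "\<lambda>v. c (the_inv_into I \<phi> v)"
    have "(\<Sum>v\<in>\<phi> ` I. ?u v *s v) = (\<Sum>i\<in>I. c i *s \<phi> i)"
      by (simp add: sum.reindex[OF inj] the_inv_into_f_f[OF inj])
    then have "?u (\<phi> i) = 0"
      using independentD[OF lin, of "\<phi> ` I" ?u "\<phi> i"] assms c i by simp
    then show "c i = 0" using the_inv_into_f_f[OF inj i] by simp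
  qed
next
  assume coeff: "\<forall>c. (\<Sum>i\<in>I. c i *s \<phi> i) = 0 \<longrightarrow> (\<forall>i\<in>I. c i = 0)"
  have inj: "inj_on \<phi> I"
  proof (rule inj_onI, rule ccontr)
    fix i j assume ij: "i \<in> I" "j \<in> I" "\<phi> i = \<phi> j" "i \<noteq> j"
    let ?c = "\<lambda>l. if l = i then (1::'a) else if l = j then - 1 else 0"
    have "(\<Sum>l\<in>I. ?c l *s \<phi> l) = (\<Sum>l\<in>{i, j}. ?c l *s \<phi> l)"
      using assms ij by (intro sum.mono_neutral_right) auto
    also have "\<dots> = 0" using ij by simp
    finally have "?c i = 0" using coeff[rule_format, of ?c i] ij by blast
    then show False by simp
  qed
  have "independent (\<phi> ` I)"
    unfolding dependent_finite[OF finite_imageI[OF assms]]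
  proof clarify
    fix u i assume u: "(\<Sum>v\<in>\<phi> ` I. u v *s v) = 0" and i: "i \<in> I" "u (\<phi> i) \<noteq> 0"
    have "(\<Sum>i\<in>I. u (\<phi> i) *s \<phi> i) = 0"
      using u by (simp add: sum.reindex[OF inj])
    then show False using coeff[rule_format, of "\<lambda>i. u (\<phi> i)" i] i by blast
  qed
  with inj show "independent_family \<phi> I" by (simp add: independent_family_def)
qed

end

(* The hard direction goes by induction on the index set E. Suppose E - {x} is partitioned into
   independent classes A i, but E admits no such partition. Repeatedly exchange the uncovered
   index x for an index y of some class A i such that A i - {y} + x is independent; y becomes
   uncovered. Let S be the set of all indices that can become uncovered in this way. The
   fundamental circuit of x in A i lies in S, so x lies in the span of A i \<inter> S, and therefore an
   exchange does not change the span of A i \<inter> S. Hence every A i \<inter> S spans all of S, and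
   card S = 1 + card K * dim S, where K is the set of class labels. *)

theory Submission
  imports Defs
begin

definition (in module) independent_partition :: "('i \<Rightarrow> 'b) \<Rightarrow> 'j set \<Rightarrow> ('j \<Rightarrow> 'i set) \<Rightarrow> 'i set \<Rightarrow> bool"
  where "independent_partition \<phi> K A E \<longleftrightarrow>
    disjoint_family_on A K \<and> (\<Union>i\<in>K. A i) = E \<and> (\<forall>i\<in>K. independent_family \<phi> (A i))"

text \<open>The last two arguments form a state: the current classes and the one index they leave
  uncovered. That the classes partition the remaining indices is not built in;
  \<open>exchange_reachable_partition\<close> carries it along.\<close>

inductive (in module) exchange_reachable ::
    "('i \<Rightarrow> 'b) \<Rightarrow> 'j set \<Rightarrow> ('j \<Rightarrow> 'i set) \<Rightarrow> 'i \<Rightarrow> ('j \<Rightarrow> 'i set) \<Rightarrow> 'i \<Rightarrow> bool"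
  for \<phi> K A0 x0 where
  start: "exchange_reachable \<phi> K A0 x0 A0 x0"
| exchange: "\<lbrakk>exchange_reachable \<phi> K A0 x0 A x; i \<in> K; y \<in> A i;
      independent_family \<phi> (insert x (A i - {y}))\<rbrakk>
    \<Longrightarrow> exchange_reachable \<phi> K A0 x0 (A(i := insert x (A i - {y}))) y"

section \<open>Fundamental circuits and independent families\<close>

context vector_space
begin

text \<open>The set on the right is the fundamental circuit of \<open>v\<close> in \<open>B\<close>,
  without \<open>v\<close> itself. A smallest \<open>C\<close> in \<open>B\<close> spanning
  \<open>v\<close> lies inside it: for \<open>b\<close> in \<open>C\<close>, minimality and the
  exchange property put \<open>b\<close> into the span of \<open>v\<close> and
  \<open>C - {b}\<close>. If \<open>v\<close> were in the span of \<open>B - {b}\<close>, so would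
  \<open>b\<close> be, against independence.\<close>

lemma in_span_fundamental_circuit:
  assumes "finite B" "independent B" "v \<in> span B"
  shows "v \<in> span {b \<in> B. v \<notin> span (B - {b})}"
proof -
  have "\<exists>C. C \<subseteq> B \<and> v \<in> span C" using assms(3) by blast
  then obtain C where C: "C \<subseteq> B" "v \<in> span C"
    and min: "\<And>D. D \<subseteq> B \<Longrightarrow> v \<in> span D \<Longrightarrow> card C \<le> card D"
    using exists_least_iff[of "\<lambda>n. \<exists>C. C \<subseteq> B \<and> v \<in> span C \<and> card C = n"]
    by (metis not_less)
  have "C \<subseteq> {b \<in> B. v \<notin> span (B - {b})}"
  proof safe
    fix b assume b: "b \<in> C" and v: "v \<in> span (B - {b})"
    have "card (C - {b}) < card C"
      using b C(1) assms(1) by (meson card_Diff1_less finite_subset)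
    then have "v \<notin> span (C - {b})" using min[of "C - {b}"] C(1) by auto
    moreover have "v \<in> span (insert b (C - {b}))" using b C(2) by (simp add: insert_absorb)
    ultimately have "b \<in> span (insert v (C - {b}))" by (rule in_span_insert[rotated])
    moreover have "span (insert v (C - {b})) \<subseteq> span (B - {b})"
      using C(1) v by (intro span_minimal) (auto intro: span_base)
    ultimately have "b \<in> span (B - {b})" by blast
    then show False using assms(2) b C(1) by (auto simp: dependent_def)
  qed (use C(1) in blast)
  then show ?thesis using C(2) span_mono by blast
qed

text \<open>\<open>B\<close> extends to a basis of \<open>V\<close> chosen inside the finite set
  \<open>V\<close>, so the ambient space may have infinite dimension.\<close>

lemma independent_card_le_dim_finite:
  assumes "finite V" "B \<subseteq> V" "independent B"
  shows "card B \<le> dim V"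
proof -
  obtain C where C: "B \<subseteq> C" "C \<subseteq> V" "independent C" "V \<subseteq> span C"
    using maximal_independent_subset_extend[OF assms(2,3)] .
  have "card B \<le> card C" using C assms(1) by (meson card_mono finite_subset)
  also have "card C = dim V" using C by (intro basis_card_eq_dim)
  finally show ?thesis .
qed

lemma independent_family_subset:
  "independent_family \<phi> I \<Longrightarrow> J \<subseteq> I \<Longrightarrow> independent_family \<phi> J"
  unfolding independent_family_def by (meson image_mono independent_mono inj_on_subset)

lemma independent_family_insert:
  assumes "x \<notin> I"
  shows "independent_family \<phi> (insert x I) \<longleftrightarrow>
    independent_family \<phi> I \<and> \<phi> x \<notin> span (\<phi> ` I)"
  using assms span_base[of "\<phi> x" "\<phi> ` I"]
  by (auto simp: independent_family_def independent_insert split: if_splits)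

lemma card_independent_family:
  "independent_family \<phi> I \<Longrightarrow> card I = dim (\<phi> ` I)"
  by (simp add: independent_family_def card_image dim_eq_card_independent)

text \<open>Every \<open>y\<close> indexing a member of the fundamental circuit can be traded for
  \<open>x\<close>, because without it \<open>\<phi> x\<close> leaves the span. Injectivity turns
  deleting the index \<open>y\<close> into deleting the vector \<open>\<phi> y\<close>.\<close>

lemma in_span_exchangeable:
  assumes "finite I" "independent_family \<phi> I" "x \<notin> I" "\<not> independent_family \<phi> (insert x I)"
  shows "\<phi> x \<in> span (\<phi> ` {y \<in> I. independent_family \<phi> (insert x (I - {y}))})"
proof -
  have inj: "inj_on \<phi> I" and ind: "independent (\<phi> ` I)"
    using assms(2) by (auto simp: independent_family_def)
  have "\<phi> x \<in> span (\<phi> ` I)"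
    using assms(2-4) independent_family_insert[of x I \<phi>] by simp
  then have "\<phi> x \<in> span {b \<in> \<phi> ` I. \<phi> x \<notin> span (\<phi> ` I - {b})}"
    by (rule in_span_fundamental_circuit[OF finite_imageI[OF assms(1)] ind])
  moreover have "{b \<in> \<phi> ` I. \<phi> x \<notin> span (\<phi> ` I - {b})}
      \<subseteq> \<phi> ` {y \<in> I. independent_family \<phi> (insert x (I - {y}))}"
  proof clarify
    fix y assume y: "y \<in> I" "\<phi> x \<notin> span (\<phi> ` I - {\<phi> y})"
    have "\<phi> ` (I - {y}) = \<phi> ` I - {\<phi> y}"
      using inj y(1) by (auto simp: inj_on_def)
    then have "independent_family \<phi> (insert x (I - {y}))"
      using independent_family_insert[of x "I - {y}" \<phi>] assms(2,3) y
        independent_family_subset[of \<phi> I "I - {y}"] by auto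
    then show "\<phi> y \<in> \<phi> ` {y \<in> I. independent_family \<phi> (insert x (I - {y}))}"
      using y(1) by blast
  qed
  ultimately show ?thesis by (meson span_mono subsetD)
qed

section \<open>Counting class by class; necessity of the inequality\<close>

lemma independent_partition_card_eq:
  assumes "independent_partition \<phi> K A E" "finite K" "finite E"
  shows "card (E \<inter> S) = (\<Sum>i\<in>K. card (A i \<inter> S))"
proof -
  have "E \<inter> S = (\<Union>i\<in>K. A i \<inter> S)"
    using assms(1) by (auto simp: independent_partition_def)
  moreover have "disjoint_family_on (\<lambda>i. A i \<inter> S) K"
    using assms(1) by (auto simp: independent_partition_def disjoint_family_on_def)
  moreover have "finite (A i)" if "i \<in> K" for i
    using assms(1,3) that by (auto simp: independent_partition_def intro: finite_subset)
  ultimately show ?thesis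
    using assms(2) card_UN_disjoint'[of "\<lambda>i. A i \<inter> S" K] by simp
qed

lemma independent_partition_imp_card_le:
  assumes "independent_partition \<phi> K A E" "finite K" "finite E" "J \<subseteq> E"
  shows "card J \<le> card K * dim (\<phi> ` J)"
proof -
  have "card J = (\<Sum>i\<in>K. card (A i \<inter> J))"
    using independent_partition_card_eq[OF assms(1-3), of J] assms(4) by (simp add: Int_absorb1)
  also have "\<dots> \<le> (\<Sum>i\<in>K. dim (\<phi> ` J))"
  proof (rule sum_mono)
    fix i assume i: "i \<in> K"
    have "independent_family \<phi> (A i \<inter> J)"
      using assms(1) i independent_family_subset[of \<phi> "A i" "A i \<inter> J"]
      by (auto simp: independent_partition_def)
    then have "card (A i \<inter> J) = card (\<phi> ` (A i \<inter> J))" "independent (\<phi> ` (A i \<inter> J))"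
      by (auto simp: independent_family_def card_image)
    then show "card (A i \<inter> J) \<le> dim (\<phi> ` J)"
      using independent_card_le_dim_finite[of "\<phi> ` J" "\<phi> ` (A i \<inter> J)"]
        finite_subset[OF assms(4,3)] by auto
  qed
  finally show ?thesis by simp
qed

section \<open>Exchanges and sufficiency of the inequality\<close>

lemma independent_partition_insert:
  assumes "independent_partition \<phi> K A E" "x \<notin> E" "i \<in> K" "independent_family \<phi> (insert x (A i))"
  shows "independent_partition \<phi> K (A(i := insert x (A i))) (insert x E)"
  using assms by (auto simp: independent_partition_def disjoint_family_on_def)

lemma independent_partition_exchange:
  assumes "independent_partition \<phi> K A (E - {x})" "x \<in> E" "i \<in> K" "y \<in> A i"
    and "independent_family \<phi> (insert x (A i - {y}))"
  shows "independent_partition \<phi> K (A(i := insert x (A i - {y}))) (E - {y})"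
proof -
  have disj: "A j \<inter> A l = {}" if "j \<in> K" "l \<in> K" "j \<noteq> l" for j l
    using assms(1) that by (auto simp: independent_partition_def disjoint_family_on_def)
  have U: "(\<Union>j\<in>K. A j) = E - {x}"
    using assms(1) by (simp add: independent_partition_def)
  have y: "y \<notin> A j" if "j \<in> K" "j \<noteq> i" for j
    using disj[OF that(1) assms(3) that(2)] assms(4) by blast
  have "x \<notin> A j" if "j \<in> K" for j using U that by blast
  then have D: "disjoint_family_on (A(i := insert x (A i - {y}))) K"
    using disj assms(3) by (fastforce simp: disjoint_family_on_def)
  have "(\<Union>j\<in>K. (A(i := insert x (A i - {y}))) j) = insert x (A i - {y}) \<union> (\<Union>j\<in>K - {i}. A j)"
    using assms(3) by (auto split: if_splits)
  also have "\<dots> = insert x ((\<Union>j\<in>K. A j) - {y})"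
    using assms(3) y by auto
  also have "\<dots> = E - {y}"
    using U assms(2-4) by auto
  finally show ?thesis
    using D assms(1,5) by (auto simp: independent_partition_def)
qed

lemma exchange_reachable_partition:
  assumes "exchange_reachable \<phi> K A0 x0 A x"
    and "independent_partition \<phi> K A0 (E - {x0})" "x0 \<in> E"
  shows "independent_partition \<phi> K A (E - {x}) \<and> x \<in> E"
  using assms(1)
proof induction
  case start
  then show ?case using assms by blast
next
  case (exchange A x i y)
  then have "y \<in> E" by (auto simp: independent_partition_def)
  then show ?case
    using exchange independent_partition_exchange[of \<phi> K A E x i y] by blast
qed

lemma no_partition_imp_card_gt:
  assumes fin: "finite K" "finite E" and "x0 \<in> E"
    and part: "independent_partition \<phi> K A0 (E - {x0})"
    and nopart: "\<nexists>A. independent_partition \<phi> K A E"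
  shows "\<exists>S\<subseteq>E. card S > card K * dim (\<phi> ` S)"
proof -
  let ?R = "exchange_reachable \<phi> K A0 x0"
  define S where "S = {x. \<exists>A. ?R A x}"
  note R_part = exchange_reachable_partition[OF _ part \<open>x0 \<in> E\<close>]
  have "S \<subseteq> E" using R_part by (auto simp: S_def)
  have "x0 \<in> S" unfolding S_def by (blast intro: exchange_reachable.start)
  have classD: "finite (A i)" "independent_family \<phi> (A i)" "x \<notin> A i" if "?R A x" "i \<in> K" for A x i
    using R_part[OF that(1)] that(2) fin(2)
    by (auto simp: independent_partition_def intro: finite_subset[of _ "E - {x}"])
  \<comment> \<open>If \<open>x\<close> could simply join \<open>A i\<close>, all of
    \<open>E\<close> would be partitioned. So \<open>x\<close> has a fundamental circuit in
    \<open>A i\<close>, and each of its members becomes uncovered by one further exchange.\<close>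
  have uncovered: "\<phi> x \<in> span (\<phi> ` (A i \<inter> S))" if R: "?R A x" and i: "i \<in> K" for A x i
  proof -
    have "\<not> independent_family \<phi> (insert x (A i))"
      using independent_partition_insert[of \<phi> K A "E - {x}" x i] R_part[OF R] i nopart
      by (auto simp: insert_absorb)
    then have "\<phi> x \<in> span (\<phi> ` {y \<in> A i. independent_family \<phi> (insert x (A i - {y}))})"
      by (intro in_span_exchangeable classD[OF R i])
    moreover have "{y \<in> A i. independent_family \<phi> (insert x (A i - {y}))} \<subseteq> A i \<inter> S"
      unfolding S_def by (blast intro: exchange_reachable.exchange[OF R i])
    ultimately show ?thesis by (meson image_mono span_mono subsetD)
  qed
  have span_invariant: "span (\<phi> ` (A j \<inter> S)) = span (\<phi> ` (A0 j \<inter> S))"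
    if R: "?R A x" and j: "j \<in> K" for A x j
    using R
  proof induction
    case start
    show ?case ..
  next
    case (exchange A x i y)
    show ?case
    proof (cases "j = i")
      case False
      then show ?thesis using exchange by simp
    next
      case True
      let ?B = "A i \<inter> S"
      \<comment> \<open>\<open>y\<close> is uncovered after the exchange and \<open>x\<close> before
        it, so both lie in \<open>S\<close>, and intersecting with \<open>S\<close> still trades
        \<open>y\<close> for \<open>x\<close>.\<close>
      have "?R (A(i := insert x (A i - {y}))) y"
        using exchange.hyps by (rule exchange_reachable.exchange)
      then have "y \<in> S" by (auto simp: S_def)
      then have B: "?B = insert y (?B - {y})" using exchange.hyps by blast
      have "x \<in> S" using exchange.hyps(1) by (auto simp: S_def)
      then have new: "insert x (A i - {y}) \<inter> S = insert x (?B - {y})" by blast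
      have x: "\<phi> x \<in> span (\<phi> ` ?B)" using uncovered exchange.hyps by blast
      \<comment> \<open>Independence of the new class keeps \<open>\<phi> x\<close> out of the span
        of the rest, so the exchange property recovers \<open>\<phi> y\<close> from
        \<open>\<phi> x\<close> and the rest.\<close>
      have "\<phi> x \<notin> span (\<phi> ` (A i - {y}))"
        using independent_family_insert[of x "A i - {y}" \<phi>] classD(3) exchange.hyps by blast
      then have "\<phi> x \<notin> span (\<phi> ` (?B - {y}))"
        using span_mono[of "\<phi> ` (?B - {y})" "\<phi> ` (A i - {y})"] by blast
      moreover have "\<phi> x \<in> span (insert (\<phi> y) (\<phi> ` (?B - {y})))"
        using x B by (metis image_insert)
      ultimately have y: "\<phi> y \<in> span (\<phi> ` insert x (?B - {y}))"
        using in_span_insert by simp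
      have "span (\<phi> ` insert x (?B - {y})) = span (\<phi> ` ?B)"
        unfolding span_eq
      proof
        show "\<phi> ` insert x (?B - {y}) \<subseteq> span (\<phi> ` ?B)"
          using x by (auto intro: span_base)
        show "\<phi> ` ?B \<subseteq> span (\<phi> ` insert x (?B - {y}))"
        proof clarify
          fix z assume "z \<in> A i" "z \<in> S"
          then show "\<phi> z \<in> span (\<phi> ` insert x (?B - {y}))"
            using y by (cases "z = y") (auto intro: span_base)
        qed
      qed
      then show ?thesis using exchange.IH True new by simp
    qed
  qed
  have "card (A0 i \<inter> S) = dim (\<phi> ` S)" if i: "i \<in> K" for i
  proof -
    \<comment> \<open>Each member of \<open>S\<close> is uncovered in a state of its own; the
      invariance of the spans brings all these states back to the single family
      \<open>A0\<close>.\<close>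
    have "\<phi> ` S \<subseteq> span (\<phi> ` (A0 i \<inter> S))"
      using uncovered span_invariant i by (fastforce simp: S_def)
    then have "span (\<phi> ` S) = span (\<phi> ` (A0 i \<inter> S))"
      unfolding span_eq by (auto intro: span_base)
    then have "dim (\<phi> ` S) = dim (\<phi> ` (A0 i \<inter> S))" by (rule span_eq_dim)
    also have "\<dots> = card (A0 i \<inter> S)"
      using independent_family_subset[OF classD(2)[OF exchange_reachable.start i], of "A0 i \<inter> S"]
      by (simp add: card_independent_family)
    finally show ?thesis ..
  qed
  then have "card ((E - {x0}) \<inter> S) = card K * dim (\<phi> ` S)"
    using independent_partition_card_eq[OF part fin(1)] fin(2) by simp
  \<comment> \<open>\<open>x0\<close> is in \<open>S\<close> but in no class of \<open>A0\<close>;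
    this one extra index violates the inequality.\<close>
  moreover have "card ((E - {x0}) \<inter> S) < card S"
    using \<open>x0 \<in> S\<close> \<open>S \<subseteq> E\<close> fin(2) by (intro psubset_card_mono) (auto intro: finite_subset)
  ultimately show ?thesis using \<open>S \<subseteq> E\<close> by auto
qed

lemma card_le_imp_independent_partition:
  assumes "finite K" "finite E" "\<And>J. J \<subseteq> E \<Longrightarrow> card J \<le> card K * dim (\<phi> ` J)"
  shows "\<exists>A. independent_partition \<phi> K A E"
  using assms(2,3)
proof (induction E rule: finite_induct)
  case empty
  have "independent_partition \<phi> K (\<lambda>_. {}) {}"
    by (auto simp: independent_partition_def disjoint_family_on_def independent_family_def
        independent_empty)
  then show ?case by blast
next
  \<comment> \<open>The inequality passes to subsets of \<open>E\<close>, so the induction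
    hypothesis partitions \<open>E\<close>, written as \<open>insert x E - {x}\<close> to serve as
    the start of the exchanges.\<close>
  case (insert x E)
  then obtain A where "independent_partition \<phi> K A (insert x E - {x})"
    by (metis Diff_insert_absorb subset_insertI2)
  then show ?case
    using no_partition_imp_card_gt[of K "insert x E" x \<phi> A] assms(1) insert
    by (meson finite_insert insertI1 not_less)
qed

end

theorem theorem1p1:
  fixes scale :: "'k::field \<Rightarrow> 'v::ab_group_add \<Rightarrow> 'v"
    and \<phi> :: "nat \<Rightarrow> 'v"
    and M k :: nat
  assumes "vector_space scale"
    and "k \<ge> 1"
  shows "(\<exists>A :: nat \<Rightarrow> nat set.
            disjoint_family_on A {1..k} \<and> (\<Union>i\<in>{1..k}. A i) = {1..M} \<and>
            (\<forall>i\<in>{1..k}. module.independent_family scale \<phi> (A i)))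
     \<longleftrightarrow> (\<forall>J \<subseteq> {1..M}.
            card J \<le> k * vector_space.dim scale (module.span scale (\<phi> ` J)))"
proof -
  interpret vector_space scale by fact
  have "(\<exists>A :: nat \<Rightarrow> nat set. independent_partition \<phi> {1..k} A {1..M}) \<longleftrightarrow>
      (\<forall>J \<subseteq> {1..M}. card J \<le> card {1..k} * dim (\<phi> ` J))"
    using independent_partition_imp_card_le[of \<phi> "{1..k}" _ "{1..M}"]
      card_le_imp_independent_partition[of "{1..k}" "{1..M}" \<phi>] by blast
  then show ?thesis by (simp add: independent_partition_def)
qed

end
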